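(* Fix $L\ge0$ and $g(x)=\frac L2\|x\|^2$ on $\mathbb{R}^d$ ($d\ge1$), and let $\sigma\ge0$. For any $T\ge1$ and any sequences of positive step sizes $\{\gamma_k\}_{k=0}^{T-1}$, $\{\eta^0_k\}_{k=0}^{T-1}$, $\{\eta^1_k\}_{k=0}^{T-1}$, there exists a difference-of-convex function $f=g-h$ with $$h(x)=\frac a2\|x\|^2,\qquad a:=\max_{0\le k<T}\Big(2L+\frac{\gamma_k}{\eta^0_k\eta^1_k}\Big),$$ and a stochastic gradient oracle $\nabla h(x,\xi):=\nabla h(x)+\xi$, $\xi\sim\mathcal{N}(0,\sigma^2I_d)$, which is unbiased with uniformly bounded variance (property (BV) of the context) but does not have uniformly bounded second moment (property (BS) of the context fails), such that the sequence $\{x_k\}_{k=1}^T$ produced by the SMAG algorithm (defined in the context) satisfies $$\mathbb{E}\big[\|\nabla f(x_k)\|^2\big]\ge\sigma^2\qquad\text{for all }1\le k\le T.$$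
   Context: SMAG algorithm (single-loop stochastic Moreau-envelope method without momentum), applied to $f=g-h$ with the exact gradient of $g$ and the stochastic gradient of $h$: from arbitrary initial points $x_0,x^g_0,x^h_0\in\mathbb{R}^d$, for $t=0,\dots,T-1$ draw $\xi_t$ (i.i.d., independent of all earlier iterates) and set $$x^g_{t+1}=x^g_t-\eta^1_t\Big(\nabla g(x^g_t)+\frac{x^g_t-x_t}{\gamma_t}\Big),\qquad x^h_{t+1}=x^h_t-\eta^1_t\Big(\nabla h(x^h_t,\xi_t)+\frac{x^h_t-x_t}{\gamma_t}\Big),$$ $$x_{t+1}=x_t-\frac{\eta^0_t}{\gamma_t}\big(x^h_{t+1}-x^g_{t+1}\big).$$ Properties of a stochastic gradient oracle $\nabla h(x,\xi)$ of a smooth convex function $h$: (BV) $h$ has Lipschitz gradient, $\mathbb{E}[\nabla h(x,\xi)]=\nabla h(x)$ for all $x$, and there is a finite constant $V$ with $\mathbb{E}\|\nabla h(x,\xi)-\nabla h(x)\|^2\le V$ for all $x\in\mathbb{R}^d$. (BS) $\mathbb{E}[\nabla h(x,\xi)]=\nabla h(x)$ for all $x$, and there is a finite constant $M\ge0$ with $\mathbb{E}\|\nabla h(x,\xi)\|^2\le M^2$ for all $x\in\mathbb{R}^d$. *)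

theory Defs
  imports "HOL-Probability.Probability"
begin

definition gradient :: "('v::euclidean_space \<Rightarrow> real) \<Rightarrow> 'v \<Rightarrow> 'v" where
  "gradient f x = (THE D. GDERIV f x :> D)"

definition dc_decomposition ::
    "('v::euclidean_space \<Rightarrow> real) \<Rightarrow> ('v \<Rightarrow> real) \<Rightarrow> ('v \<Rightarrow> real) \<Rightarrow> bool" where
  "dc_decomposition f g h \<longleftrightarrow>
     convex_on UNIV g \<and> convex_on UNIV h \<and> f = (\<lambda>x. g x - h x)"

(* The law N(0, \<sigma>^2 I_d), as the image of a standard Gaussian vector under scaling by \<sigma>,
   so that \<sigma> = 0 gives the Dirac measure at 0 (where normal_density 0 0 would be no density). *)
definition isotropic_gaussian :: "real \<Rightarrow> (real ^ 'd) measure" where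
  "isotropic_gaussian \<sigma> =
     distr (PiM UNIV (\<lambda>_::'d. density lborel std_normal_density)) borel
       (\<lambda>z. \<chi> i. \<sigma> * z i)"

(* Below, D is the law of the sample \<xi> and G x \<xi> is the stochastic gradient of h at x. *)

definition unbiased_oracle ::
    "'w measure \<Rightarrow> ('v::euclidean_space \<Rightarrow> 'w \<Rightarrow> 'v) \<Rightarrow> ('v \<Rightarrow> real) \<Rightarrow> bool" where
  "unbiased_oracle D G h \<longleftrightarrow>
     (\<forall>x. integrable D (G x) \<and> (\<integral>\<xi>. G x \<xi> \<partial>D) = gradient h x)"

(* The second moments are nonnegative integrals, so that a non-integrable square counts as
   infinite and not as 0. *)

definition bounded_variance_oracle ::
    "'w measure \<Rightarrow> ('v::euclidean_space \<Rightarrow> 'w \<Rightarrow> 'v) \<Rightarrow> ('v \<Rightarrow> real) \<Rightarrow> bool" where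
  "bounded_variance_oracle D G h \<longleftrightarrow>
     (\<forall>x. h differentiable (at x)) \<and>
     (\<exists>C. C-lipschitz_on UNIV (gradient h)) \<and>
     unbiased_oracle D G h \<and>
     (\<exists>V::real. \<forall>x. (\<integral>\<^sup>+\<xi>. ennreal ((norm (G x \<xi> - gradient h x))\<^sup>2) \<partial>D) \<le> ennreal V)"

definition bounded_second_moment_oracle ::
    "'w measure \<Rightarrow> ('v::euclidean_space \<Rightarrow> 'w \<Rightarrow> 'v) \<Rightarrow> ('v \<Rightarrow> real) \<Rightarrow> bool" where
  "bounded_second_moment_oracle D G h \<longleftrightarrow>
     unbiased_oracle D G h \<and>
     (\<exists>M::real. M \<ge> 0 \<and> (\<forall>x. (\<integral>\<^sup>+\<xi>. ennreal ((norm (G x \<xi>))\<^sup>2) \<partial>D) \<le> ennreal (M\<^sup>2)))"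

fun smag_step ::
    "('v::euclidean_space \<Rightarrow> 'v) \<Rightarrow> ('v \<Rightarrow> 'w \<Rightarrow> 'v) \<Rightarrow> real \<Rightarrow> real \<Rightarrow> real \<Rightarrow>
     'w \<Rightarrow> 'v \<times> 'v \<times> 'v \<Rightarrow> 'v \<times> 'v \<times> 'v" where
  "smag_step dg G \<gamma> \<eta>0 \<eta>1 \<xi> (x, xg, xh) =
     (let xg' = xg - \<eta>1 *\<^sub>R (dg xg + (xg - x) /\<^sub>R \<gamma>);
          xh' = xh - \<eta>1 *\<^sub>R (G xh \<xi> + (xh - x) /\<^sub>R \<gamma>)
      in (x - (\<eta>0 / \<gamma>) *\<^sub>R (xh' - xg'), xg', xh'))"

(* The state after t steps, for the given initial state (x, xg, xh) and sample path \<xi>. *)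
primrec smag ::
    "('v::euclidean_space \<Rightarrow> 'v) \<Rightarrow> ('v \<Rightarrow> 'w \<Rightarrow> 'v) \<Rightarrow>
     (nat \<Rightarrow> real) \<Rightarrow> (nat \<Rightarrow> real) \<Rightarrow> (nat \<Rightarrow> real) \<Rightarrow>
     'v \<times> 'v \<times> 'v \<Rightarrow> (nat \<Rightarrow> 'w) \<Rightarrow> nat \<Rightarrow> 'v \<times> 'v \<times> 'v" where
  "smag dg G \<gamma> \<eta>0 \<eta>1 s0 \<xi> 0 = s0"
| "smag dg G \<gamma> \<eta>0 \<eta>1 s0 \<xi> (Suc t) =
     smag_step dg G (\<gamma> t) (\<eta>0 t) (\<eta>1 t) (\<xi> t) (smag dg G \<gamma> \<eta>0 \<eta>1 s0 \<xi> t)"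

end

theory Submission
  imports Defs
begin

text \<open>
  Both gradients are linear, so every iterate is an affine combination of the samples drawn so
  far, and the last one enters \<open>x\<^sub>k\<close> with coefficient \<open>\<eta>\<^sup>0\<eta>\<^sup>1 / \<gamma>\<close>.  It is centred and
  uncorrelated with the rest, so it alone contributes \<open>(\<eta>\<^sup>0\<eta>\<^sup>1 / \<gamma>)\<^sup>2 \<sigma>\<^sup>2 d\<close> to the second moment
  of \<open>x\<^sub>k\<close>.  The choice of \<open>a\<close> makes the gradient of \<open>f\<close> multiply by a factor
  of modulus at least \<open>\<gamma> / (\<eta>\<^sup>0\<eta>\<^sup>1)\<close>, which cancels the coefficient.
\<close>

section \<open>Calculus of the quadratics \<open>c / 2 * (norm x)\<^sup>2\<close>\<close>

lemma GDERIV_half_norm_sq: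
  "GDERIV (\<lambda>x. c / 2 * (norm (x :: 'a::euclidean_space))\<^sup>2) x :> c *\<^sub>R x"
  unfolding gderiv_def power2_norm_eq_inner
  by (auto intro!: derivative_eq_intros simp: inner_commute)

text \<open>Uniqueness of the derivative lets the definite description in \<open>gradient\<close> be
  evaluated.\<close>

lemma gradient_eqI:
  assumes "GDERIV f x :> D"
  shows "gradient f x = D"
  unfolding gradient_def
proof (rule the_equality[where P="\<lambda>D. GDERIV f x :> D", OF assms])
  fix E assume "GDERIV f x :> E"
  then have "(\<lambda>h. h \<bullet> E) = (\<lambda>h. h \<bullet> D)"
    using assms unfolding gderiv_def by (rule has_derivative_unique)
  then show "E = D"
    by (metis inner_commute vector_eq_ldot)
qed

lemma gradient_half_norm_sq:
  "gradient (\<lambda>x. c / 2 * (norm x)\<^sup>2) = (*\<^sub>R) c"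
  by (intro ext gradient_eqI GDERIV_half_norm_sq)

text \<open>The gap in the convexity inequality is exactly a nonnegative multiple of the squared
  distance of the two points.\<close>

lemma convex_on_half_norm_sq:
  assumes "c \<ge> 0"
  shows "convex_on UNIV (\<lambda>x::'a::euclidean_space. c / 2 * (norm x)\<^sup>2)"
proof (rule convex_onI)
  fix t :: real and x y :: 'a
  assume t: "0 < t" "t < 1"
  have "(1 - t) * (c / 2 * (norm x)\<^sup>2) + t * (c / 2 * (norm y)\<^sup>2)
      - c / 2 * (norm ((1 - t) *\<^sub>R x + t *\<^sub>R y))\<^sup>2 = c / 2 * (t * (1 - t) * (norm (x - y))\<^sup>2)"
    unfolding power2_norm_eq_inner
    by (simp add: inner_simps inner_commute field_simps)
  also have "\<dots> \<ge> 0"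
    using t assms by simp
  finally show "c / 2 * (norm ((1 - t) *\<^sub>R x + t *\<^sub>R y))\<^sup>2
      \<le> (1 - t) * (c / 2 * (norm x)\<^sup>2) + t * (c / 2 * (norm y)\<^sup>2)"
    by simp
qed simp

section \<open>Square-integrable random vectors and orthogonality in L2\<close>

text \<open>Measurability of \<open>X\<close> is a separate conjunct because integrability of the
  squared norm does not imply it.\<close>

definition square_integrable :: "'w measure \<Rightarrow> ('w \<Rightarrow> 'v::euclidean_space) \<Rightarrow> bool" where
  "square_integrable M X \<longleftrightarrow> X \<in> borel_measurable M \<and> integrable M (\<lambda>\<omega>. (norm (X \<omega>))\<^sup>2)"

text \<open>Cauchy-Schwarz and the inequality between arithmetic and geometric means dominate the
  inner product by the sum of the squared norms.\<close>

lemma square_integrable_inner: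
  assumes "square_integrable M X" "square_integrable M Y"
  shows "integrable M (\<lambda>\<omega>. X \<omega> \<bullet> Y \<omega>)"
proof (rule Bochner_Integration.integrable_bound)
  show "integrable M (\<lambda>\<omega>. (norm (X \<omega>))\<^sup>2 + (norm (Y \<omega>))\<^sup>2)"
    using assms by (simp add: square_integrable_def)
  show "(\<lambda>\<omega>. X \<omega> \<bullet> Y \<omega>) \<in> borel_measurable M"
    using assms by (intro borel_measurable_inner) (simp_all add: square_integrable_def)
  have "\<bar>x \<bullet> y\<bar> \<le> (norm x)\<^sup>2 + (norm y)\<^sup>2" for x y :: 'b
  proof -
    have "2 * \<bar>x \<bullet> y\<bar> \<le> 2 * (norm x * norm y)"
      using Cauchy_Schwarz_ineq2[of x y] by simp
    also have "\<dots> \<le> (norm x)\<^sup>2 + (norm y)\<^sup>2"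
      using sum_squares_bound[of "norm x" "norm y"] by simp
    finally show ?thesis
      by linarith
  qed
  then show "AE \<omega> in M. norm (X \<omega> \<bullet> Y \<omega>) \<le> norm ((norm (X \<omega>))\<^sup>2 + (norm (Y \<omega>))\<^sup>2)"
    by simp
qed

lemma square_integrable_add:
  assumes "square_integrable M X" "square_integrable M Y"
  shows "square_integrable M (\<lambda>\<omega>. X \<omega> + Y \<omega>)"
proof -
  have "(norm (X \<omega> + Y \<omega>))\<^sup>2 = (norm (X \<omega>))\<^sup>2 + 2 * (X \<omega> \<bullet> Y \<omega>) + (norm (Y \<omega>))\<^sup>2" for \<omega>
    unfolding power2_norm_eq_inner by (simp add: inner_simps inner_commute)
  then show ?thesis
    using assms square_integrable_inner[OF assms]
    by (auto simp: square_integrable_def intro: borel_measurable_add)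
qed

lemma square_integrable_scaleR:
  "square_integrable M X \<Longrightarrow> square_integrable M (\<lambda>\<omega>. c *\<^sub>R X \<omega>)"
  by (auto simp: square_integrable_def power_mult_distrib intro: borel_measurable_scaleR)

lemma (in finite_measure) square_integrable_const: "square_integrable M (\<lambda>\<omega>. c)"
  by (simp add: square_integrable_def)

text \<open>On a finite measure L2 lies in L1, because \<open>r \<le> 1 + r\<^sup>2\<close>.\<close>

lemma (in finite_measure) square_integrable_integrable:
  assumes "square_integrable M X"
  shows "integrable M X"
proof (rule Bochner_Integration.integrable_bound)
  show "integrable M (\<lambda>\<omega>. 1 + (norm (X \<omega>))\<^sup>2)" "X \<in> borel_measurable M"
    using assms by (simp_all add: square_integrable_def)
  have "r \<le> 1 + r\<^sup>2" if "r \<ge> 0" for r :: real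
    using that sum_squares_bound[of r 1] by simp
  then show "AE \<omega> in M. norm (X \<omega>) \<le> norm (1 + (norm (X \<omega>))\<^sup>2)"
    by simp
qed

text \<open>Square integrability of both factors is built in so that the vanishing integral is a
  genuine value and not the default 0 of a non-integrable function. The set \<open>S\<close> will
  consist of samples not drawn yet.\<close>

definition orthogonal_to :: "'w measure \<Rightarrow> ('w \<Rightarrow> 'v::euclidean_space) set \<Rightarrow> ('w \<Rightarrow> 'v) \<Rightarrow> bool"
  where "orthogonal_to M S X \<longleftrightarrow>
    square_integrable M X \<and> (\<forall>Z\<in>S. square_integrable M Z \<and> (\<integral>\<omega>. X \<omega> \<bullet> Z \<omega> \<partial>M) = 0)"

lemma orthogonal_to_add:
  "orthogonal_to M S X \<Longrightarrow> orthogonal_to M S Y \<Longrightarrow> orthogonal_to M S (\<lambda>\<omega>. X \<omega> + Y \<omega>)"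
  by (auto simp: orthogonal_to_def inner_add_left square_integrable_inner square_integrable_add)

lemma orthogonal_to_scaleR:
  "orthogonal_to M S X \<Longrightarrow> orthogonal_to M S (\<lambda>\<omega>. c *\<^sub>R X \<omega>)"
  by (auto simp: orthogonal_to_def square_integrable_inner square_integrable_scaleR)

lemma orthogonal_to_diff:
  assumes "orthogonal_to M S X" "orthogonal_to M S Y"
  shows "orthogonal_to M S (\<lambda>\<omega>. X \<omega> - Y \<omega>)"
  using orthogonal_to_add[OF assms(1) orthogonal_to_scaleR[OF assms(2), of "-1"]] by simp

lemma orthogonal_to_mono: "orthogonal_to M S X \<Longrightarrow> R \<subseteq> S \<Longrightarrow> orthogonal_to M R X"
  by (auto simp: orthogonal_to_def)

text \<open>Pythagoras in L2: the cross term integrates to 0.\<close>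

lemma second_moment_orthogonal_add:
  assumes "orthogonal_to M S X" "Z \<in> S"
  shows "(\<integral>\<omega>. (norm (X \<omega> + c *\<^sub>R Z \<omega>))\<^sup>2 \<partial>M) =
    (\<integral>\<omega>. (norm (X \<omega>))\<^sup>2 \<partial>M) + c\<^sup>2 * (\<integral>\<omega>. (norm (Z \<omega>))\<^sup>2 \<partial>M)"
proof -
  have X: "square_integrable M X" and Z: "square_integrable M Z"
    and 0: "(\<integral>\<omega>. X \<omega> \<bullet> Z \<omega> \<partial>M) = 0"
    using assms by (auto simp: orthogonal_to_def)
  have "(norm (X \<omega> + c *\<^sub>R Z \<omega>))\<^sup>2
      = (norm (X \<omega>))\<^sup>2 + 2 * c * (X \<omega> \<bullet> Z \<omega>) + c\<^sup>2 * (norm (Z \<omega>))\<^sup>2" for \<omega>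
    unfolding power2_norm_eq_inner
    by (simp add: inner_simps inner_commute algebra_simps power2_eq_square)
  then show ?thesis
    using X Z 0 square_integrable_inner[OF X Z] by (simp add: square_integrable_def)
qed

section \<open>Moments of the isotropic Gaussian law\<close>

lemma borel_measurable_vec_nth [measurable]: "(\<lambda>x :: real ^ 'd. x $ i) \<in> borel_measurable borel"
  by (intro borel_measurable_continuous_onI continuous_intros)

lemma borel_measurable_vec_lambda:
  assumes "\<And>i. (\<lambda>z. f z i) \<in> borel_measurable M"
  shows "(\<lambda>z. (\<chi> i. f z i) :: real ^ 'd) \<in> borel_measurable M"
  unfolding borel_measurable_euclidean_space[where 'c="real ^ 'd"]
  using assms by (auto simp: Basis_vec_def inner_axis)

lemma norm_power2_eq_sum_vec: "(norm (x :: real ^ 'd))\<^sup>2 = (\<Sum>i\<in>UNIV. (x $ i)\<^sup>2)"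
  unfolding power2_norm_eq_inner by (simp add: inner_vec_def power2_eq_square)

lemma isotropic_gaussian_measurable [measurable]:
  "(\<lambda>z. \<chi> i. \<sigma> * z i) \<in>
     PiM UNIV (\<lambda>_::'d. density lborel std_normal_density) \<rightarrow>\<^sub>M (borel :: (real ^ 'd) measure)"
  by (intro borel_measurable_vec_lambda) measurable

lemma sets_isotropic_gaussian [simp, measurable_cong]:
  "sets (isotropic_gaussian \<sigma>) = sets borel"
  by (simp add: isotropic_gaussian_def)

lemma prob_space_std_normal_PiM:
  "prob_space (PiM UNIV (\<lambda>_::'d. density lborel std_normal_density))"
  by (intro prob_space_PiM prob_space_normal_density) simp

lemma prob_space_isotropic_gaussian:
  "prob_space (isotropic_gaussian \<sigma> :: (real ^ 'd) measure)"
  unfolding isotropic_gaussian_def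
  by (intro prob_space.prob_space_distr prob_space_std_normal_PiM isotropic_gaussian_measurable)

text \<open>Each component of the product measure has the standard normal law, and taking a
  coordinate commutes with scaling. An image measure, unlike a density, also covers
  \<open>\<sigma> = 0\<close>.\<close>

lemma distr_isotropic_gaussian_nth:
  "distr (isotropic_gaussian \<sigma> :: (real ^ 'd) measure) borel (\<lambda>x. x $ i) =
     distr (density lborel std_normal_density) borel (\<lambda>z. \<sigma> * z)"
proof -
  have "distr (isotropic_gaussian \<sigma> :: (real ^ 'd) measure) borel (\<lambda>x. x $ i) =
      distr (PiM UNIV (\<lambda>_::'d. density lborel std_normal_density)) borel (\<lambda>z. \<sigma> * z i)"
    unfolding isotropic_gaussian_def by (subst distr_distr) (auto simp: comp_def)
  also have "\<dots> = distr (distr (PiM UNIV (\<lambda>_::'d. density lborel std_normal_density))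
      (density lborel std_normal_density) (\<lambda>z. z i)) borel (\<lambda>z. \<sigma> * z)"
    by (subst distr_distr) (auto simp: comp_def)
  also have "distr (PiM UNIV (\<lambda>_::'d. density lborel std_normal_density))
      (density lborel std_normal_density) (\<lambda>z. z i) = density lborel std_normal_density"
    by (intro distr_PiM_component prob_space_normal_density) auto
  finally show ?thesis .
qed

lemma isotropic_gaussian_nth_moments:
  fixes i :: "'d::finite"
  shows "integrable (isotropic_gaussian \<sigma>) (\<lambda>x :: real ^ 'd. (x $ i) ^ k)"
    and "(\<integral>x. x $ i \<partial>(isotropic_gaussian \<sigma> :: (real ^ 'd) measure)) = 0"
    and "(\<integral>x. (x $ i)\<^sup>2 \<partial>(isotropic_gaussian \<sigma> :: (real ^ 'd) measure)) = \<sigma>\<^sup>2"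
proof -
  let ?N = "isotropic_gaussian \<sigma> :: (real ^ 'd) measure"
  \<comment> \<open>A change of variables reduces everything to moments of the one-dimensional
    standard normal law.\<close>
  have integrable_iff: "integrable ?N (\<lambda>x. \<phi> (x $ i)) \<longleftrightarrow>
      integrable (density lborel std_normal_density) (\<lambda>z. \<phi> (\<sigma> * z))"
    and integral_eq: "(\<integral>x. \<phi> (x $ i) \<partial>?N) =
      (\<integral>z. \<phi> (\<sigma> * z) \<partial>density lborel std_normal_density)"
    if [measurable]: "\<phi> \<in> borel_measurable borel" for \<phi> :: "real \<Rightarrow> real"
  proof -
    show "integrable ?N (\<lambda>x. \<phi> (x $ i)) \<longleftrightarrow>
        integrable (density lborel std_normal_density) (\<lambda>z. \<phi> (\<sigma> * z))"
      using arg_cong[OF distr_isotropic_gaussian_nth[of \<sigma> i], of "\<lambda>M. integrable M \<phi>"]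
      by (simp add: integrable_distr_eq)
    show "(\<integral>x. \<phi> (x $ i) \<partial>?N) = (\<integral>z. \<phi> (\<sigma> * z) \<partial>density lborel std_normal_density)"
      using arg_cong[OF distr_isotropic_gaussian_nth[of \<sigma> i], of "\<lambda>M. integral\<^sup>L M \<phi>"]
      by (simp add: integral_distr)
  qed
  show "integrable ?N (\<lambda>x. (x $ i) ^ k)"
    by (subst integrable_iff)
       (simp_all add: power_mult_distrib integrable_std_normal_distribution_moment)
  show "(\<integral>x. x $ i \<partial>?N) = 0"
    using integral_eq[of "\<lambda>x. x"] integral_std_normal_distribution_moment_odd[of 1] by simp
  \<comment> \<open>The formula for even moments, (2k)! / (2^k k!), equals 1 at k = 1.\<close>
  show "(\<integral>x. (x $ i)\<^sup>2 \<partial>?N) = \<sigma>\<^sup>2"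
    using integral_eq[of "\<lambda>x. x\<^sup>2"] std_normal_distribution_even_moments(1)[of 1]
    by (simp add: power_mult_distrib fact_numeral)
qed

lemma isotropic_gaussian_second_moment:
  "(\<integral>x. (norm x)\<^sup>2 \<partial>(isotropic_gaussian \<sigma> :: (real ^ 'd) measure)) = real CARD('d) * \<sigma>\<^sup>2"
  by (simp add: norm_power2_eq_sum_vec isotropic_gaussian_nth_moments)

lemma square_integrable_isotropic_gaussian:
  "square_integrable (isotropic_gaussian \<sigma> :: (real ^ 'd) measure) (\<lambda>x. x)"
  by (simp add: square_integrable_def norm_power2_eq_sum_vec isotropic_gaussian_nth_moments)

lemma isotropic_gaussian_mean:
  "(\<integral>x. x \<partial>(isotropic_gaussian \<sigma> :: (real ^ 'd) measure)) = 0"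
proof -
  interpret prob_space "isotropic_gaussian \<sigma> :: (real ^ 'd) measure"
    by (rule prob_space_isotropic_gaussian)
  have "(\<integral>x. x \<partial>(isotropic_gaussian \<sigma> :: (real ^ 'd) measure)) $ i = 0" for i
    using integral_bounded_linear[OF bounded_linear_vec_nth[of i]
        square_integrable_integrable[OF square_integrable_isotropic_gaussian[of \<sigma>]]]
    by (simp add: isotropic_gaussian_nth_moments)
  then show ?thesis
    by (simp add: vec_eq_iff)
qed

text \<open>Integrating the inner product with \<open>c\<close> gives the inner product of
  \<open>c\<close> with the mean, which is 0.\<close>

lemma orthogonal_to_isotropic_gaussian_const:
  "orthogonal_to (isotropic_gaussian \<sigma>) {\<lambda>x. x} (\<lambda>_. c :: real ^ 'd)"
proof -
  interpret prob_space "isotropic_gaussian \<sigma> :: (real ^ 'd) measure"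
    by (rule prob_space_isotropic_gaussian)
  show ?thesis
    using square_integrable_integrable[OF square_integrable_isotropic_gaussian[of \<sigma>]]
    by (simp add: orthogonal_to_def square_integrable_const square_integrable_isotropic_gaussian
        isotropic_gaussian_mean)
qed

text \<open>Pythagoras for a constant and centred noise, in the nonnegative-integral form of the
  oracle definitions. Taking \<open>c = 0\<close> yields the variance, and letting \<open>c\<close>
  grow refutes a bound on second moments.\<close>

lemma isotropic_gaussian_shifted_second_moment:
  "(\<integral>\<^sup>+x. ennreal ((norm (c + x :: real ^ 'd))\<^sup>2) \<partial>isotropic_gaussian \<sigma>) =
     ennreal ((norm c)\<^sup>2 + real CARD('d) * \<sigma>\<^sup>2)"
proof -
  interpret prob_space "isotropic_gaussian \<sigma> :: (real ^ 'd) measure"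
    by (rule prob_space_isotropic_gaussian)
  have "square_integrable (isotropic_gaussian \<sigma>) (\<lambda>x. c + x)"
    by (intro square_integrable_add square_integrable_const square_integrable_isotropic_gaussian)
  then have "(\<integral>\<^sup>+x. ennreal ((norm (c + x))\<^sup>2) \<partial>isotropic_gaussian \<sigma>) =
      ennreal (\<integral>x. (norm (c + x))\<^sup>2 \<partial>isotropic_gaussian \<sigma>)"
    by (intro nn_integral_eq_integral) (auto simp: square_integrable_def)
  also have "(\<integral>x. (norm (c + x))\<^sup>2 \<partial>isotropic_gaussian \<sigma>) = (norm c)\<^sup>2 + real CARD('d) * \<sigma>\<^sup>2"
    using second_moment_orthogonal_add[OF orthogonal_to_isotropic_gaussian_const, of "\<lambda>x. x" \<sigma> c 1]
    by (simp add: isotropic_gaussian_second_moment prob_space)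
  finally show ?thesis .
qed

section \<open>Properties of the oracle with additive Gaussian noise\<close>

lemma unbiased_additive_gaussian_oracle:
  "unbiased_oracle (isotropic_gaussian \<sigma>) (\<lambda>x \<xi>. gradient h x + \<xi>) (h :: real ^ 'd \<Rightarrow> real)"
proof -
  interpret prob_space "isotropic_gaussian \<sigma> :: (real ^ 'd) measure"
    by (rule prob_space_isotropic_gaussian)
  show ?thesis
    using square_integrable_integrable[OF square_integrable_isotropic_gaussian[of \<sigma>]]
    by (simp add: unbiased_oracle_def isotropic_gaussian_mean prob_space)
qed

lemma bounded_variance_additive_gaussian_oracle:
  fixes h :: "real ^ 'd \<Rightarrow> real"
  assumes "h = (\<lambda>x. a / 2 * (norm x)\<^sup>2)"
  shows "bounded_variance_oracle (isotropic_gaussian \<sigma>) (\<lambda>x \<xi>. gradient h x + \<xi>) h"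
  unfolding bounded_variance_oracle_def
proof (intro conjI allI exI)
  show "h differentiable at x" for x
    using GDERIV_half_norm_sq[of a x] unfolding assms gderiv_def differentiable_def by blast
  show "\<bar>a\<bar>-lipschitz_on UNIV (gradient h)"
    unfolding assms gradient_half_norm_sq
    by (auto intro!: lipschitz_onI simp: dist_norm simp flip: scaleR_diff_right)
  show "unbiased_oracle (isotropic_gaussian \<sigma>) (\<lambda>x \<xi>. gradient h x + \<xi>) h"
    by (rule unbiased_additive_gaussian_oracle)
  show "(\<integral>\<^sup>+\<xi>. ennreal ((norm (gradient h x + \<xi> - gradient h x))\<^sup>2) \<partial>isotropic_gaussian \<sigma>)
      \<le> ennreal (real CARD('d) * \<sigma>\<^sup>2)" for x
    using isotropic_gaussian_shifted_second_moment[of \<sigma> "0 :: real ^ 'd"] by simp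
qed

text \<open>The second moment at \<open>x\<close> is at least the squared norm of the exact gradient
  \<open>a *\<^sub>R x\<close>, which is unbounded even when \<open>\<sigma> = 0\<close>.\<close>

lemma not_bounded_second_moment_additive_gaussian_oracle:
  fixes h :: "real ^ 'd \<Rightarrow> real"
  assumes h: "h = (\<lambda>x. a / 2 * (norm x)\<^sup>2)" and a: "a > 0"
  shows "\<not> bounded_second_moment_oracle (isotropic_gaussian \<sigma>) (\<lambda>x \<xi>. gradient h x + \<xi>) h"
proof
  assume "bounded_second_moment_oracle (isotropic_gaussian \<sigma>) (\<lambda>x \<xi>. gradient h x + \<xi>) h"
  then obtain M where M: "M \<ge> 0" and bound:
    "\<And>x. (\<integral>\<^sup>+\<xi>. ennreal ((norm (a *\<^sub>R x + \<xi> :: real ^ 'd))\<^sup>2) \<partial>isotropic_gaussian \<sigma>) \<le> ennreal (M\<^sup>2)"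
    unfolding bounded_second_moment_oracle_def h gradient_half_norm_sq by auto
  obtain e :: "real ^ 'd" where "norm e = 1"
    using vector_choose_size[of 1] by auto
  \<comment> \<open>At the chosen point the exact gradient has norm \<open>M + 1\<close>, which
    exceeds \<open>M\<close> without any help from the noise term.\<close>
  then have "(M + 1)\<^sup>2 + real CARD('d) * \<sigma>\<^sup>2 \<le> M\<^sup>2"
    using bound[of "((M + 1) / a) *\<^sub>R e"] a M
    by (simp add: isotropic_gaussian_shifted_second_moment del: ennreal_plus)
  moreover have "0 \<le> real CARD('d) * \<sigma>\<^sup>2"
    by simp
  ultimately have "(M + 1)\<^sup>2 \<le> M\<^sup>2"
    by linarith
  then show False
    using M by (simp add: power2_eq_square algebra_simps)
qed

section \<open>SMAG driven by independent Gaussian samples\<close>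

text \<open>The sample enters \<open>xh'\<close> with factor \<open>- \<eta>1\<close>, and
  \<open>xh'\<close> enters the new \<open>x\<close> with factor
  \<open>- \<eta>0 / \<gamma>\<close>. The remainder is the same step run with sample 0.\<close>

lemma fst_smag_step:
  "fst (smag_step dg (\<lambda>x \<xi>. G x + \<xi>) \<gamma> \<eta>0 \<eta>1 \<xi> s) =
    fst (smag_step dg (\<lambda>x \<xi>. G x + \<xi>) \<gamma> \<eta>0 \<eta>1 0 s) + (\<eta>0 * \<eta>1 / \<gamma>) *\<^sub>R \<xi>"
  by (cases s) (simp add: Let_def scaleR_add_right scaleR_diff_right)

locale iid_gaussian_samples = prob_space P
  for P :: "'w measure" +
  fixes \<xi> :: "nat \<Rightarrow> 'w \<Rightarrow> real ^ 'd" and T :: nat and \<sigma> :: real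
  assumes indep: "indep_vars (\<lambda>_. borel) \<xi> {..<T}"
    and distr_sample: "\<And>t. t < T \<Longrightarrow> distr P borel (\<xi> t) = isotropic_gaussian \<sigma>"
begin

lemma sample_measurable [measurable]: "t < T \<Longrightarrow> \<xi> t \<in> borel_measurable P"
  using indep by (simp add: indep_vars_def)

lemma sample_integral:
  fixes \<phi> :: "real ^ 'd \<Rightarrow> 'b::{banach, second_countable_topology}"
  assumes "t < T" and [measurable]: "\<phi> \<in> borel_measurable borel"
  shows "(\<integral>\<omega>. \<phi> (\<xi> t \<omega>) \<partial>P) = (\<integral>x. \<phi> x \<partial>isotropic_gaussian \<sigma>)"
  unfolding distr_sample[OF assms(1), symmetric] using assms(1) by (simp add: integral_distr)

lemma sample_integrable:
  fixes \<phi> :: "real ^ 'd \<Rightarrow> 'b::{banach, second_countable_topology}"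
  assumes "t < T" and "integrable (isotropic_gaussian \<sigma>) \<phi>"
  shows "integrable P (\<lambda>\<omega>. \<phi> (\<xi> t \<omega>))"
  using assms(2) unfolding distr_sample[OF assms(1), symmetric]
  by (rule integrable_distr[OF sample_measurable[OF assms(1)]])

lemma square_integrable_sample: "t < T \<Longrightarrow> square_integrable P (\<xi> t)"
  using square_integrable_isotropic_gaussian[of \<sigma>] sample_integrable[of t "\<lambda>x. (norm x)\<^sup>2"]
  by (simp add: square_integrable_def)

text \<open>Coordinates of distinct samples are independent scalars, so the expectation of their
  product factorises into means, which vanish.\<close>

lemma samples_uncorrelated:
  assumes "s < T" "t < T" "s \<noteq> t"
  shows "(\<integral>\<omega>. \<xi> s \<omega> \<bullet> \<xi> t \<omega> \<partial>P) = 0"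
proof -
  \<comment> \<open>Restricting to the pair \<open>{s, t}\<close> turns the general product rule
    into one with two factors.\<close>
  have ind: "indep_vars (\<lambda>_. borel) (\<lambda>r \<omega>. \<xi> r \<omega> $ i) {s, t}" for i
    using indep_vars_compose2[OF indep_vars_subset[OF indep], of "{s, t}" "\<lambda>_ x. x $ i" "\<lambda>_. borel"]
      assms by auto
  have int: "integrable P (\<lambda>\<omega>. \<xi> r \<omega> $ i)" if "r \<in> {s, t}" for r i
    using that assms sample_integrable[of r "\<lambda>x. x $ i"] isotropic_gaussian_nth_moments(1)[of \<sigma> i 1]
    by auto
  have "integrable P (\<lambda>\<omega>. \<xi> s \<omega> $ i * \<xi> t \<omega> $ i)" for i
    using indep_vars_integrable[OF _ ind int] assms by simp
  moreover have "(\<integral>\<omega>. \<xi> s \<omega> $ i * \<xi> t \<omega> $ i \<partial>P) = 0" for i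
    using indep_vars_lebesgue_integral[OF _ ind int] assms
      sample_integral[of s "\<lambda>x. x $ i"] isotropic_gaussian_nth_moments(2)[of \<sigma> i]
    by simp
  ultimately show ?thesis
    by (simp add: inner_vec_def)
qed

lemma orthogonal_to_samples_const:
  assumes "S \<subseteq> \<xi> ` {..<T}"
  shows "orthogonal_to P S (\<lambda>\<omega>. c)"
  unfolding orthogonal_to_def
proof (intro conjI ballI)
  fix Z assume "Z \<in> S"
  then obtain t where "Z = \<xi> t" "t < T"
    using assms by auto
  then show "square_integrable P Z" "(\<integral>\<omega>. c \<bullet> Z \<omega> \<partial>P) = 0"
    using sample_integral[of t "\<lambda>x. c \<bullet> x"] orthogonal_to_isotropic_gaussian_const[of \<sigma> c]
    by (simp_all add: orthogonal_to_def square_integrable_sample)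
qed (rule square_integrable_const)

lemma orthogonal_to_samples_sample:
  assumes "s < T" "S \<subseteq> \<xi> ` ({..<T} - {s})"
  shows "orthogonal_to P S (\<xi> s)"
  unfolding orthogonal_to_def
proof (intro conjI ballI)
  fix Z assume "Z \<in> S"
  then obtain t where "Z = \<xi> t" "t < T" "t \<noteq> s"
    using assms(2) by auto
  then show "square_integrable P Z" "(\<integral>\<omega>. \<xi> s \<omega> \<bullet> Z \<omega> \<partial>P) = 0"
    using assms(1) by (auto simp: square_integrable_sample samples_uncorrelated)
qed (rule square_integrable_sample[OF assms(1)])

text \<open>With linear gradients, each new component is a linear combination of the old state and
  the sample, and orthogonality to \<open>S\<close> is closed under these. \<open>Z\<close> is
  arbitrary so that it can be a true sample or the constant 0.\<close>

lemma orthogonal_to_smag_step: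
  fixes L a \<gamma> \<eta>0 \<eta>1 :: real
  assumes "orthogonal_to P S x" "orthogonal_to P S xg" "orthogonal_to P S xh" "orthogonal_to P S Z"
  defines "Y \<equiv> \<lambda>\<omega>. smag_step ((*\<^sub>R) L) (\<lambda>x \<xi>. a *\<^sub>R x + \<xi>) \<gamma> \<eta>0 \<eta>1 (Z \<omega>)
    (x \<omega>, xg \<omega>, xh \<omega>)"
  shows "orthogonal_to P S (\<lambda>\<omega>. fst (Y \<omega>))"
    and "orthogonal_to P S (\<lambda>\<omega>. fst (snd (Y \<omega>)))"
    and "orthogonal_to P S (\<lambda>\<omega>. snd (snd (Y \<omega>)))"
  unfolding Y_def smag_step.simps Let_def fst_conv snd_conv
  by (intro orthogonal_to_add orthogonal_to_diff orthogonal_to_scaleR assms(1-4))+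

text \<open>After \<open>k\<close> steps the state is built from constants and the samples before
  index \<open>k\<close>, all of them uncorrelated with the later ones. The three components feed
  each other and therefore go through one joint induction.\<close>

lemma smag_orthogonal_to_later_samples:
  fixes L a :: real and \<gamma> \<eta>0 \<eta>1 :: "nat \<Rightarrow> real" and s0
  assumes "k \<le> T"
  defines "X \<equiv> \<lambda>\<omega>. smag ((*\<^sub>R) L) (\<lambda>x \<xi>. a *\<^sub>R x + \<xi>) \<gamma> \<eta>0 \<eta>1 s0 (\<lambda>t. \<xi> t \<omega>) k"
  shows "orthogonal_to P (\<xi> ` {k..<T}) (\<lambda>\<omega>. fst (X \<omega>))"
    and "orthogonal_to P (\<xi> ` {k..<T}) (\<lambda>\<omega>. fst (snd (X \<omega>)))"
    and "orthogonal_to P (\<xi> ` {k..<T}) (\<lambda>\<omega>. snd (snd (X \<omega>)))"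
  using assms(1) unfolding X_def
proof (induction k)
  case 0
  { case 1 show ?case by (simp add: orthogonal_to_samples_const lessThan_atLeast0) }
  { case 2 show ?case by (simp add: orthogonal_to_samples_const lessThan_atLeast0) }
  { case 3 show ?case by (simp add: orthogonal_to_samples_const lessThan_atLeast0) }
next
  case (Suc k)
  \<comment> \<open>The new state contains \<open>\<xi> k\<close>, so the claim is narrowed to the
    samples after it.\<close>
  have sub: "\<xi> ` {Suc k..<T} \<subseteq> \<xi> ` {k..<T}"
    by (intro image_mono) auto
  have "orthogonal_to P (\<xi> ` {Suc k..<T}) (\<xi> k)" if "Suc k \<le> T"
    using that by (intro orthogonal_to_samples_sample image_mono) auto
  note step = orthogonal_to_smag_step[OF Suc.IH[THEN orthogonal_to_mono[OF _ sub]] this]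
  { case 1 then show ?case using step(1) by (simp only: smag.simps prod.collapse) }
  { case 2 then show ?case using step(2) by (simp only: smag.simps prod.collapse) }
  { case 3 then show ?case using step(3) by (simp only: smag.simps prod.collapse) }
qed

text \<open>Pythagoras separates the contribution of \<open>\<xi> k\<close> from the rest of the
  iterate, whose second moment is nonnegative and is dropped. The bound concerns the iterate after
  step \<open>k\<close>, hence the index \<open>Suc k\<close>.\<close>

lemma smag_second_moment_ge:
  assumes "k < T"
  shows "(\<eta>0 k * \<eta>1 k / \<gamma> k)\<^sup>2 * (real CARD('d) * \<sigma>\<^sup>2) \<le> (\<integral>\<omega>. (norm (fst (smag ((*\<^sub>R) L)
    (\<lambda>x \<xi>. a *\<^sub>R x + \<xi>) \<gamma> \<eta>0 \<eta>1 s0 (\<lambda>t. \<xi> t \<omega>) (Suc k))))\<^sup>2 \<partial>P)"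
proof -
  let ?c = "\<eta>0 k * \<eta>1 k / \<gamma> k"
  let ?X = "\<lambda>\<omega>. smag ((*\<^sub>R) L) (\<lambda>x \<xi>. a *\<^sub>R x + \<xi>) \<gamma> \<eta>0 \<eta>1 s0 (\<lambda>t. \<xi> t \<omega>) k"
  define U where "U \<omega> =
    fst (smag_step ((*\<^sub>R) L) (\<lambda>x \<xi>. a *\<^sub>R x + \<xi>) (\<gamma> k) (\<eta>0 k) (\<eta>1 k) 0 (?X \<omega>))" for \<omega>
  \<comment> \<open>The constant 0 fills the sample slot in \<open>U\<close>, so \<open>U\<close>
    stays orthogonal to \<open>\<xi> k\<close> itself and not only to later samples.\<close>
  have "orthogonal_to P (\<xi> ` {k..<T}) (\<lambda>_. 0)"
    by (intro orthogonal_to_samples_const image_mono) auto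
  note orthogonal_to_smag_step(1)[OF smag_orthogonal_to_later_samples[OF less_imp_le[OF assms(1)],
        where L=L and a=a and \<gamma>=\<gamma> and ?\<eta>0.0=\<eta>0 and ?\<eta>1.0=\<eta>1
        and ?s0.0=s0] this,
      where L=L and a=a and \<gamma>="\<gamma> k" and ?\<eta>0.0="\<eta>0 k" and ?\<eta>1.0="\<eta>1 k"]
  then have "orthogonal_to P (\<xi> ` {k..<T}) U"
    unfolding U_def by (simp only: prod.collapse)
  then have "(\<integral>\<omega>. (norm (U \<omega> + ?c *\<^sub>R \<xi> k \<omega>))\<^sup>2 \<partial>P)
      = (\<integral>\<omega>. (norm (U \<omega>))\<^sup>2 \<partial>P) + ?c\<^sup>2 * (\<integral>\<omega>. (norm (\<xi> k \<omega>))\<^sup>2 \<partial>P)"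
    by (rule second_moment_orthogonal_add) (use assms in auto)
  also have "(\<integral>\<omega>. (norm (\<xi> k \<omega>))\<^sup>2 \<partial>P) = real CARD('d) * \<sigma>\<^sup>2"
    using sample_integral[of k "\<lambda>x. (norm x)\<^sup>2"] assms by (simp add: isotropic_gaussian_second_moment)
  finally show ?thesis
    using assms by (simp add: U_def fst_smag_step[where \<xi>="\<xi> k _"])
qed

end

section \<open>Lower bound on the expected squared gradient along SMAG\<close>

theorem proposition6:
  fixes L \<sigma> a :: real
    and g :: "real ^ 'd \<Rightarrow> real"
    and T :: nat
    and \<gamma> \<eta>0 \<eta>1 :: "nat \<Rightarrow> real"
  assumes "L \<ge> 0"
    and "g = (\<lambda>x. L / 2 * (norm x)\<^sup>2)"
    and "\<sigma> \<ge> 0"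
    and "T \<ge> 1"
    and "\<And>k. k < T \<Longrightarrow> \<gamma> k > 0"
    and "\<And>k. k < T \<Longrightarrow> \<eta>0 k > 0"
    and "\<And>k. k < T \<Longrightarrow> \<eta>1 k > 0"
    and "a = (MAX k\<in>{..<T}. 2 * L + \<gamma> k / (\<eta>0 k * \<eta>1 k))"
  shows "\<exists>(f :: real ^ 'd \<Rightarrow> real) (h :: real ^ 'd \<Rightarrow> real)
            (G :: real ^ 'd \<Rightarrow> real ^ 'd \<Rightarrow> real ^ 'd).
           dc_decomposition f g h \<and>
           h = (\<lambda>x. a / 2 * (norm x)\<^sup>2) \<and>
           G = (\<lambda>x \<xi>. gradient h x + \<xi>) \<and>
           bounded_variance_oracle (isotropic_gaussian \<sigma>) G h \<and>
           \<not> bounded_second_moment_oracle (isotropic_gaussian \<sigma>) G h \<and>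
           (\<forall>(P :: 'w measure) (\<xi> :: nat \<Rightarrow> 'w \<Rightarrow> real ^ 'd) x0 xg0 xh0.
              prob_space P \<longrightarrow>
              prob_space.indep_vars P (\<lambda>_. borel) \<xi> {..<T} \<longrightarrow>
              (\<forall>t<T. distr P borel (\<xi> t) = isotropic_gaussian \<sigma>) \<longrightarrow>
              (\<forall>k\<in>{1..T}.
                 prob_space.expectation P
                   (\<lambda>\<omega>. (norm (gradient f
                      (fst (smag (gradient g) G \<gamma> \<eta>0 \<eta>1 (x0, xg0, xh0) (\<lambda>t. \<xi> t \<omega>) k))))\<^sup>2)
                 \<ge> \<sigma>\<^sup>2))"
proof -
  \<comment> \<open>Taking \<open>f\<close> as a single quadratic makes its gradient multiplication
    by \<open>L - a\<close>; that it equals \<open>g - h\<close> is checked with the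
    decomposition.\<close>
  define f h :: "real ^ 'd \<Rightarrow> real" where "f = (\<lambda>x. (L - a) / 2 * (norm x)\<^sup>2)"
    and "h = (\<lambda>x. a / 2 * (norm x)\<^sup>2)"
  have grad: "gradient f = (*\<^sub>R) (L - a)" "gradient g = (*\<^sub>R) L" "gradient h = (*\<^sub>R) a"
    unfolding f_def h_def assms(2) by (rule gradient_half_norm_sq)+
  have a_ge: "2 * L + \<gamma> k / (\<eta>0 k * \<eta>1 k) \<le> a" if "k < T" for k
    unfolding assms(8) using that by (intro Max_ge) auto
  have ratio_pos: "\<gamma> k / (\<eta>0 k * \<eta>1 k) > 0" if "k < T" for k
    using that assms by simp
  \<comment> \<open>As \<open>T \<ge> 1\<close>, index 0 takes part in the maximum. Positivity of
    \<open>a\<close> serves both the convexity of \<open>h\<close> and the failure of the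
    second-moment bound.\<close>
  have a_pos: "a > 0"
    using a_ge[of 0] ratio_pos[of 0] assms(1,4) by simp
  have "dc_decomposition f g h"
    using convex_on_half_norm_sq[OF assms(1)] convex_on_half_norm_sq[of a] a_pos
    by (auto simp: dc_decomposition_def f_def h_def assms(2) field_simps)
  moreover have "\<sigma>\<^sup>2 \<le> prob_space.expectation P (\<lambda>\<omega>. (norm (gradient f
      (fst (smag (gradient g) (\<lambda>x \<xi>. gradient h x + \<xi>) \<gamma> \<eta>0 \<eta>1 s0 (\<lambda>t. \<xi> t \<omega>) k))))\<^sup>2)"
    if "prob_space P" "prob_space.indep_vars P (\<lambda>_. borel) \<xi> {..<T}"
      "\<forall>t<T. distr P borel (\<xi> t) = isotropic_gaussian \<sigma>" "k \<in> {1..T}"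
    for P :: "'w measure" and \<xi> :: "nat \<Rightarrow> 'w \<Rightarrow> real ^ 'd" and s0 k
  proof -
    interpret prob_space P by fact
    interpret iid_gaussian_samples P \<xi> T \<sigma>
      using that by unfold_locales auto
    \<comment> \<open>The iterate with index \<open>k\<close> is produced by step
      \<open>k - 1\<close>, so the step sizes at \<open>j\<close> govern the bound.\<close>
    obtain j where j: "k = Suc j" "j < T"
      using \<open>k \<in> {1..T}\<close> by (cases k) auto
    define c where "c = \<eta>0 j * \<eta>1 j / \<gamma> j"
    have c: "c > 0" "\<gamma> j / (\<eta>0 j * \<eta>1 j) = 1 / c"
      using j assms by (auto simp: c_def)
    \<comment> \<open>From \<open>a \<ge> 2 * L + 1 / c\<close> and \<open>L \<ge> 0\<close>. Thus
      the gradient of \<open>f\<close> amplifies by at least the reciprocal of the noise coefficient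
      \<open>c\<close>.\<close>
    have "1 / c \<le> a - L"
      using a_ge[OF j(2)] assms(1) c(2) by simp
    then have "1 \<le> (a - L) * c"
      using c(1) by (simp add: field_simps)
    \<comment> \<open>Both the squared product and the dimension \<open>CARD('d)\<close> are at
      least 1; the left side is shaped to match the factors.\<close>
    then have "1 * (1 * \<sigma>\<^sup>2) \<le> ((a - L) * c)\<^sup>2 * (real CARD('d) * \<sigma>\<^sup>2)"
      by (intro mult_mono mult_right_mono) (auto simp: one_le_power Suc_leI)
    also have "\<dots> = (L - a)\<^sup>2 * (c\<^sup>2 * (real CARD('d) * \<sigma>\<^sup>2))"
      by (simp add: power_mult_distrib power2_commute)
    also have "\<dots> \<le> (L - a)\<^sup>2 * expectation (\<lambda>\<omega>. (norm (fst (smag ((*\<^sub>R) L)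
        (\<lambda>x \<xi>. a *\<^sub>R x + \<xi>) \<gamma> \<eta>0 \<eta>1 s0 (\<lambda>t. \<xi> t \<omega>) k)))\<^sup>2)"
      unfolding c_def j(1) using j(2)
      by (intro mult_left_mono smag_second_moment_ge) auto
    finally show ?thesis
      by (simp add: grad power_mult_distrib)
  qed
  ultimately show ?thesis
    using bounded_variance_additive_gaussian_oracle[OF h_def]
      not_bounded_second_moment_additive_gaussian_oracle[OF h_def a_pos]
    by (intro exI[of _ f] exI[of _ h] exI[of _ "\<lambda>x \<xi>. gradient h x + \<xi>"]) (auto simp: h_def)
qed

end
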